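(* A witnessing implementation $I$ is consistent with a weak-visibility specification $W$ if the transition system $[\![W]\!]_\mathrm{s}$ of $W$ simulates $I$.
   Context: An abstract execution is a triple $\langle h, \mathit{lin}, \mathit{vis}\rangle$ of a history $h$, a linearization relation and a visibility relation; $e_\emptyset=\langle h_\emptyset,\emptyset,\emptyset\rangle$ is the empty execution. The abstract-execution actions are the history actions (call, ret, hb) together with $\mathrm{lin}(o)$ and $\mathrm{vis}(o,o')$. For a sequence of actions $\vec a$, $f_{\mathrm{e}}(e,\vec a)$ denotes the abstract execution obtained from $e$ by applying the actions of $\vec a$ in order (call/ret/hb update the history, $\mathrm{lin}(o)$ appends $o$ to the linearization, $\mathrm{vis}(o,o')$ adds $\langle o,o'\rangle$ to visibility, other actions ignored). A witnessing implementation is a labeled transition system whose actions include the abstract-execution actions; it is consistent with $W$ iff its histories are included in those of $W$. The transition system $[\![W]\!]_\mathrm{s}$ has abstract executions as states, the empty execution as initial state, and transitions $e_1\xrightarrow{\vec a} e_2$ iff $f_{\mathrm{e}}(e_1,\vec a)=e_2$ and $e_2$ is consistent with $W$. A simulation relation from $\Sigma_1=\langle Q_1,A_1,\chi_1,\to_1\rangle$ to $\Sigma_2=\langle Q_2,A_2,\chi_2,\to_2\rangle$ is $R\subseteq Q_1\times Q_2$ with $R(\chi_1,\chi_2)$ such that whenever $R(q_1,q_2)$ and $q_1\xrightarrow{\vec a_1}_1 q_1'$, there is $q_2\xrightarrow{\vec a_2}_2 q_2'$ with $R(q_1',q_2')$ and $(\vec a_1\mid A_2)=(\vec a_2\mid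 A_1)$ (projections onto the other system's actions); $\Sigma_2$ simulates $\Sigma_1$ when such a relation exists. *)

theory Defs
  imports Main
begin

section \<open>Weak-visibility specifications\<close>

text \<open>An operation label \<open>(m, x, y)\<close> is a method name with its argument and return values.\<close>

type_synonym ('m, 'x) op_label = "'m \<times> 'x \<times> 'x"

datatype visibility = Absolute | Monotonic

record ('m, 'x) wv_spec =
  seq_spec :: "('m, 'x) op_label list set"
  read_only :: "('m, 'x) op_label \<Rightarrow> bool"
  visibility_of :: "'m \<Rightarrow> visibility"

definition compatible :: "(('m, 'x) op_label \<Rightarrow> bool) \<Rightarrow> ('m, 'x) op_label list set \<Rightarrow> bool" where
  "compatible R S \<longleftrightarrow> (\<forall>xs l ys. xs @ l # ys \<in> S \<and> R l \<longrightarrow> xs @ ys \<in> S)"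

definition weak_visibility_spec :: "('m, 'x) wv_spec \<Rightarrow> bool" where
  "weak_visibility_spec W \<longleftrightarrow> compatible (read_only W) (seq_spec W)"


section \<open>Histories\<close>

record ('m, 'x) history =
  ops :: "nat set"
  inv_of :: "nat \<Rightarrow> ('m \<times> 'x) option"
  ret_of :: "nat \<Rightarrow> 'x option"
  hb_of :: "nat rel"

definition empty_history :: "('m, 'x) history" where
  "empty_history = \<lparr>ops = {}, inv_of = Map.empty, ret_of = Map.empty, hb_of = {}\<rparr>"

definition is_history :: "('m, 'x) history \<Rightarrow> bool" where
  "is_history h \<longleftrightarrow>
     dom (inv_of h) = ops h \<and> dom (ret_of h) \<subseteq> ops h \<and>
     hb_of h \<subseteq> ops h \<times> ops h \<and> irrefl (hb_of h) \<and> trans (hb_of h)"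

text \<open>Meaningful only for operations with defined invocation and return.\<close>

definition label :: "('m, 'x) history \<Rightarrow> nat \<Rightarrow> ('m, 'x) op_label" where
  "label h n = (fst (the (inv_of h n)), snd (the (inv_of h n)), the (ret_of h n))"


section \<open>Abstract executions\<close>

text \<open>
  A linearization is represented by the reflexive version of the total order, so that its domain
  \<open>Field lin\<close> is determined even when it has a single element; the operations strictly preceding
  \<open>n\<close> are \<open>underS lin n\<close>. The pair \<open>(n, n')\<close> is in \<open>vis\<close> when \<open>n\<close> observes \<open>n'\<close>.
\<close>

record ('m, 'x) aexec =
  hist :: "('m, 'x) history"
  lin :: "nat rel"
  vis :: "nat rel"

definition empty_aexec :: "('m, 'x) aexec" where
  "empty_aexec = \<lparr>hist = empty_history, lin = {}, vis = {}\<rparr>"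

text \<open>
  Pending operations need not be linearized yet, completed ones must be. For a complete history
  this says that \<open>l\<close> is a total order over all operations that includes happens-before.
\<close>

definition linearization :: "('m, 'x) history \<Rightarrow> nat rel \<Rightarrow> bool" where
  "linearization h l \<longleftrightarrow>
     linear_order_on (Field l) l \<and>
     dom (ret_of h) \<subseteq> Field l \<and> Field l \<subseteq> ops h \<and>
     (\<forall>n n'. (n', n) \<in> hb_of h \<and> n \<in> Field l \<longrightarrow> (n', n) \<in> l)"

text \<open>
  The visibility of an operation that is not linearized yet is unconstrained: a pending operation
  may record what it observes before it is itself appended to the linearization.
\<close>

definition visibility_projection :: "('m, 'x) history \<Rightarrow> nat rel \<Rightarrow> nat rel \<Rightarrow> bool" where
  "visibility_projection h l v \<longleftrightarrow>
     v \<subseteq> ops h \<times> ops h \<and> (\<forall>n\<in>Field l. v `` {n} \<subseteq> underS l n)"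

definition abstract_execution :: "('m, 'x) aexec \<Rightarrow> bool" where
  "abstract_execution e \<longleftrightarrow>
     is_history (hist e) \<and> linearization (hist e) (lin e) \<and>
     visibility_projection (hist e) (lin e) (vis e)"

definition absolute_visibility :: "('m, 'x) aexec \<Rightarrow> nat \<Rightarrow> bool" where
  "absolute_visibility e n \<longleftrightarrow> vis e `` {n} = underS (lin e) n"

definition monotonic_visibility ::
    "(('m, 'x) op_label \<Rightarrow> bool) \<Rightarrow> ('m, 'x) aexec \<Rightarrow> nat \<Rightarrow> bool" where
  "monotonic_visibility R e n \<longleftrightarrow>
     (let H = (hb_of (hist e))\<inverse> `` {n}
      in {n' \<in> H \<union> vis e `` H. \<not> R (label (hist e) n')} \<subseteq> vis e `` {n})"

definition consistent_visibility ::
    "(('m, 'x) op_label \<Rightarrow> bool) \<Rightarrow> ('m \<Rightarrow> visibility) \<Rightarrow> ('m, 'x) aexec \<Rightarrow> bool" where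
  "consistent_visibility R V e \<longleftrightarrow>
     (\<forall>n\<in>Field (lin e).
        case V (fst (the (inv_of (hist e) n))) of
          Absolute \<Rightarrow> absolute_visibility e n
        | Monotonic \<Rightarrow> monotonic_visibility R e n)"

text \<open>\<open>enumerates l A ns\<close>: the list \<open>ns\<close> is the restriction of the total order \<open>l\<close> to \<open>A\<close>.\<close>

definition enumerates :: "nat rel \<Rightarrow> nat set \<Rightarrow> nat list \<Rightarrow> bool" where
  "enumerates l A ns \<longleftrightarrow> distinct ns \<and> set ns = A \<and> sorted_wrt (\<lambda>n n'. (n, n') \<in> l) ns"

definition consistent_seq_spec :: "('m, 'x) op_label list set \<Rightarrow> ('m, 'x) aexec \<Rightarrow> bool" where
  "consistent_seq_spec S e \<longleftrightarrow>
     (\<forall>n\<in>Field (lin e).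
        \<exists>ns. enumerates (lin e) (insert n (vis e `` {n})) ns \<and> map (label (hist e)) ns \<in> S)"

text \<open>Every linearized yet pending operation receives some return value.\<close>

definition completion :: "('m, 'x) aexec \<Rightarrow> ('m, 'x) aexec \<Rightarrow> bool" where
  "completion e e' \<longleftrightarrow>
     (\<exists>r. ret_of (hist e) \<subseteq>\<^sub>m r \<and> dom r = Field (lin e) \<and> e' = e\<lparr>hist := (hist e)\<lparr>ret_of := r\<rparr>\<rparr>)"

definition consistent_aexec :: "('m, 'x) wv_spec \<Rightarrow> ('m, 'x) aexec \<Rightarrow> bool" where
  "consistent_aexec W e \<longleftrightarrow>
     abstract_execution e \<and>
     (\<exists>e'. completion e e' \<and>
        consistent_visibility (read_only W) (visibility_of W) e' \<and>
        consistent_seq_spec (seq_spec W) e')"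

definition consistent_history :: "('m, 'x) wv_spec \<Rightarrow> ('m, 'x) history \<Rightarrow> bool" where
  "consistent_history W h \<longleftrightarrow> (\<exists>e. hist e = h \<and> consistent_aexec W e)"

definition histories_of_spec :: "('m, 'x) wv_spec \<Rightarrow> ('m, 'x) history set" where
  "histories_of_spec W = {h. consistent_history W h}"


section \<open>Actions\<close>

datatype ('m, 'x, 'b) action =
    Call nat 'm 'x
  | Ret nat 'x
  | HB nat nat
  | Lin nat
  | Vis nat nat
  | Other 'b

definition history_actions :: "('m, 'x, 'b) action set" where
  "history_actions = {Call n m x | n m x. True} \<union> {Ret n y | n y. True} \<union> {HB n n' | n n'. True}"

definition aexec_actions :: "('m, 'x, 'b) action set" where
  "aexec_actions = history_actions \<union> {Lin n | n. True} \<union> {Vis n n' | n n'. True}"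

fun history_step :: "('m, 'x) history \<Rightarrow> ('m, 'x, 'b) action \<Rightarrow> ('m, 'x) history" where
  "history_step h (Call n m x) = h\<lparr>ops := insert n (ops h), inv_of := (inv_of h)(n \<mapsto> (m, x))\<rparr>"
| "history_step h (Ret n y) = h\<lparr>ret_of := (ret_of h)(n \<mapsto> y)\<rparr>"
| "history_step h (HB n n') = h\<lparr>hb_of := insert (n, n') (hb_of h)\<rparr>"
| "history_step h _ = h"

fun aexec_step :: "('m, 'x) aexec \<Rightarrow> ('m, 'x, 'b) action \<Rightarrow> ('m, 'x) aexec" where
  "aexec_step e (Lin n) = e\<lparr>lin := lin e \<union> {(n', n) | n'. n' \<in> insert n (Field (lin e))}\<rparr>"
| "aexec_step e (Vis n n') = e\<lparr>vis := insert (n, n') (vis e)\<rparr>"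
| "aexec_step e a = e\<lparr>hist := history_step (hist e) a\<rparr>"

definition f_h :: "('m, 'x) history \<Rightarrow> ('m, 'x, 'b) action list \<Rightarrow> ('m, 'x) history" where
  "f_h h as = foldl history_step h as"

definition f_e :: "('m, 'x) aexec \<Rightarrow> ('m, 'x, 'b) action list \<Rightarrow> ('m, 'x) aexec" where
  "f_e e as = foldl aexec_step e as"


section \<open>Labeled transition systems and simulation\<close>

text \<open>Each transition is labeled by a finite sequence of actions.\<close>

record ('q, 'a) lts =
  states :: "'q set"
  actions :: "'a set"
  init :: 'q
  trans_rel :: "('q \<times> 'a list \<times> 'q) set"

definition is_lts :: "('q, 'a) lts \<Rightarrow> bool" where
  "is_lts L \<longleftrightarrow> init L \<in> states L \<and> trans_rel L \<subseteq> states L \<times> lists (actions L) \<times> states L"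

text \<open>\<open>execution L as q\<close>: some finite execution of \<open>L\<close> has trace \<open>as\<close> and ends in \<open>q\<close>.\<close>

inductive execution :: "('q, 'a) lts \<Rightarrow> 'a list \<Rightarrow> 'q \<Rightarrow> bool" for L where
  start: "execution L [] (init L)"
| step: "execution L as q \<Longrightarrow> (q, bs, q') \<in> trans_rel L \<Longrightarrow> execution L (as @ bs) q'"

definition traces :: "('q, 'a) lts \<Rightarrow> 'a list set" where
  "traces L = {as. \<exists>q. execution L as q}"

definition proj :: "'a list \<Rightarrow> 'a set \<Rightarrow> 'a list" where
  "proj as A = filter (\<lambda>a. a \<in> A) as"

definition simulation_relation ::
    "('p, 'a) lts \<Rightarrow> ('q, 'a) lts \<Rightarrow> ('p \<times> 'q) set \<Rightarrow> bool" where
  "simulation_relation L1 L2 R \<longleftrightarrow>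
     R \<subseteq> states L1 \<times> states L2 \<and> (init L1, init L2) \<in> R \<and>
     (\<forall>q1 q2 as1 q1'. (q1, q2) \<in> R \<and> (q1, as1, q1') \<in> trans_rel L1 \<longrightarrow>
        (\<exists>as2 q2'. (q2, as2, q2') \<in> trans_rel L2 \<and> (q1', q2') \<in> R \<and>
           proj as1 (actions L2) = proj as2 (actions L1)))"

text \<open>\<open>simulates L2 L1\<close>: \<open>L2\<close> simulates \<open>L1\<close>.\<close>

definition simulates :: "('q, 'a) lts \<Rightarrow> ('p, 'a) lts \<Rightarrow> bool" where
  "simulates L2 L1 \<longleftrightarrow> (\<exists>R. simulation_relation L1 L2 R)"


section \<open>Witnessing implementations\<close>

definition witnessing_implementation :: "('q, ('m, 'x, 'b) action) lts \<Rightarrow> bool" where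
  "witnessing_implementation I \<longleftrightarrow> is_lts I \<and> aexec_actions \<subseteq> actions I"

definition histories :: "('q, ('m, 'x, 'b) action) lts \<Rightarrow> ('m, 'x) history set" where
  "histories I = f_h empty_history ` traces I"

definition consistent_impl :: "('m, 'x) wv_spec \<Rightarrow> ('q, ('m, 'x, 'b) action) lts \<Rightarrow> bool" where
  "consistent_impl W I \<longleftrightarrow> histories I \<subseteq> histories_of_spec W"

definition spec_lts :: "('m, 'x) wv_spec \<Rightarrow> (('m, 'x) aexec, ('m, 'x, 'b) action) lts" where
  "spec_lts W =
     \<lparr>states = {e. abstract_execution e},
      actions = aexec_actions,
      init = empty_aexec,
      trans_rel = {(e1, as, e2). abstract_execution e1 \<and> as \<in> lists aexec_actions \<and>
                     f_e e1 as = e2 \<and> consistent_aexec W e2}\<rparr>"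

end

theory Submission
  imports Defs
begin

text \<open>
  Every execution of the implementation is matched by an execution of the specification that
  performs the same abstract-execution actions. The state it reaches is consistent, and its history
  is that of the implementation's trace, so it witnesses the consistency of that history.
\<close>

text \<open>Transitions of \<open>spec_lts\<close> guarantee consistency only of their targets, so
  the initial state, which matches the empty trace, needs its own argument. With no operation
  linearized, the conditions on visibility and on the sequential specification are vacuous, whatever
  \<open>W\<close> is.\<close>

lemma consistent_empty_aexec: "consistent_aexec W empty_aexec"
proof -
  have "abstract_execution (empty_aexec :: ('m, 'x) aexec)"
    by (simp add: abstract_execution_def empty_aexec_def empty_history_def is_history_def
        linearization_def visibility_projection_def irrefl_def trans_def)
  moreover have "completion empty_aexec (empty_aexec :: ('m, 'x) aexec)"
    by (simp add: completion_def empty_aexec_def empty_history_def)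
  moreover have "consistent_visibility R V (empty_aexec :: ('m, 'x) aexec)" for R V
    by (simp add: consistent_visibility_def empty_aexec_def)
  moreover have "consistent_seq_spec S (empty_aexec :: ('m, 'x) aexec)" for S
    by (simp add: consistent_seq_spec_def empty_aexec_def)
  ultimately show ?thesis
    unfolding consistent_aexec_def by blast
qed

lemma hist_aexec_step: "hist (aexec_step e a) = history_step (hist e) a"
  by (cases a) simp_all

lemma hist_f_e: "hist (f_e e as) = f_h (hist e) as"
  unfolding f_e_def f_h_def by (induction as arbitrary: e) (simp_all add: hist_aexec_step)

lemma f_h_append: "f_h h (as @ bs) = f_h (f_h h as) bs"
  by (simp add: f_h_def)

lemma history_step_non_action: "a \<notin> aexec_actions \<Longrightarrow> history_step h a = h"
  by (cases a) (auto simp: aexec_actions_def history_actions_def)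

text \<open>Simulation compares labels only after projection. Histories survive this because
  \<open>history_step\<close> ignores every action that is projected away.\<close>

lemma f_h_proj: "f_h h (proj as aexec_actions) = f_h h as"
  unfolding f_h_def proj_def
  by (induction as arbitrary: h) (simp_all add: history_step_non_action)

lemma proj_superset: "as \<in> lists A \<Longrightarrow> A \<subseteq> B \<Longrightarrow> proj as B = as"
  unfolding proj_def by (auto intro!: filter_True)

lemma simulated_execution:
  assumes "execution I as q"
    and "aexec_actions \<subseteq> actions I"
    and "simulation_relation I (spec_lts W) R"
  shows "\<exists>e. (q, e) \<in> R \<and> consistent_aexec W e \<and> hist e = f_h empty_history as"
  using assms(1)
proof induction
  case start
  have "(init I, empty_aexec) \<in> R"
    using assms(3) by (simp add: simulation_relation_def spec_lts_def)
  moreover have "hist empty_aexec = f_h empty_history []"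
    by (simp add: empty_aexec_def f_h_def)
  ultimately show ?case
    using consistent_empty_aexec by blast
next
  case (step as q bs q')
  then obtain e where e: "(q, e) \<in> R" "hist e = f_h empty_history as"
    by blast
  obtain cs e' where tr: "(e, cs, e') \<in> trans_rel (spec_lts W)" and R: "(q', e') \<in> R"
    and proj: "proj bs (actions (spec_lts W)) = proj cs (actions I)"
    using assms(3) e(1) step.hyps(2) unfolding simulation_relation_def by meson
  have cs: "cs \<in> lists aexec_actions" "f_e e cs = e'" and cons: "consistent_aexec W e'"
    using tr by (simp_all add: spec_lts_def)
  \<comment> \<open>Since \<open>I\<close> has all abstract-execution actions, projecting
    \<open>cs\<close> onto the actions of \<open>I\<close> removes nothing, so the matching
    condition determines \<open>cs\<close> from \<open>bs\<close>.\<close>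
  have "proj bs aexec_actions = cs"
    using proj proj_superset[OF cs(1) assms(2)] by (simp add: spec_lts_def)
  \<comment> \<open>\<open>Lin\<close> and \<open>Vis\<close> actions in \<open>cs\<close> change
    only the other components of \<open>e\<close>, and \<open>f_h\<close> skips them too.\<close>
  then have "hist e' = f_h (hist e) bs"
    using cs(2) f_h_proj[of "hist e" bs] hist_f_e[of e cs] by simp
  then have "hist e' = f_h empty_history (as @ bs)"
    using e(2) by (simp add: f_h_append)
  with R cons show ?case
    by blast
qed

theorem theorem1:
  fixes W :: "('m, 'x) wv_spec"
    and I :: "('q, ('m, 'x, 'b) action) lts"
  assumes "weak_visibility_spec W"
    and "witnessing_implementation I"
    and "simulates (spec_lts W) I"
  shows "consistent_impl W I"
proof -
  obtain R where R: "simulation_relation I (spec_lts W) R"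
    using assms(3) unfolding simulates_def by blast
  have acts: "aexec_actions \<subseteq> actions I"
    using assms(2) by (simp add: witnessing_implementation_def)
  have "consistent_history W (f_h empty_history as)" if "execution I as q" for as q
    using simulated_execution[OF that acts R] unfolding consistent_history_def by blast
  then show ?thesis
    by (auto simp: consistent_impl_def histories_def histories_of_spec_def traces_def)
qed

end
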